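(* Let $d\ge1$, $t\ge1$, and let $D$ be a $t$-solvable distribution on the hypercube $Q^d$. Define a distribution $D'$ on $Q^{d+1}$ by $D'(\mathbf{v}\cdot0)=D_{D(\mathbf{v})}(x_0)$ and $D'(\mathbf{v}\cdot1)=D_{D(\mathbf{v})}(x_1)$ for each $\mathbf{v}\in V(Q^d)$. Then $D'$ is $t$-solvable on $Q^{d+1}$, $|D'|\le \frac43|D|+\frac23|\sigma(D)|$, and $|\sigma(D')|\le 2|\sigma(D)|$.
   Context: A distribution on a graph $G=(V,E)$ is a function $D:V\to\mathbb{N}$, with size $|D|=\sum_v D(v)$; its support is $\sigma(D)=\{v\in V: D(v)>0\}$. A pebbling move removes two pebbles from a vertex having at least two pebbles and places one pebble on a neighbor. A distribution $D$ is $t$-solvable if for every vertex $v$, some sequence of pebbling moves starting from $D$ results in a distribution with at least $t$ pebbles on $v$. The hypercube $Q^d$ has vertex set $\{0,1\}^d$ (bitstrings of length $d$), two bitstrings adjacent iff they differ in exactly one bit; $\mathbf{v}\cdot b$ is the concatenation of the bitstring $\mathbf{v}$ with the bit $b$. With $K_2$ having vertices $x_0,x_1$, for integers $k\ge0$ the distributions $D_r$ on $K_2$ are: $D_{3k}(x_0)=D_{3k}(x_1)=2k$; $D_{3k+1}(x_0)=2k+2$, $D_{3k+1}(x_1)=2k$; $D_{3k+2}(x_0)=2k+2$, $D_{3k+2}(x_1)=2k+1$ (so $D_0$ is the empty distribution). *)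

theory Defs
  imports Complex_Main "Graph_Theory.Pair_Digraph"
begin

text \<open>
  As in \<^theory>\<open>Graph_Theory.Digraph\<close>, an undirected graph is a symmetric digraph, so every edge
  is present as two arcs.  A distribution on a graph is a function on the whole vertex type; its
  values outside the vertex set are irrelevant to all notions below.
\<close>

type_synonym 'a distribution = "'a \<Rightarrow> nat"

definition dist_size :: "'a pair_pre_digraph \<Rightarrow> 'a distribution \<Rightarrow> nat" where
  "dist_size G D = (\<Sum>v\<in>pverts G. D v)"

definition dist_support :: "'a pair_pre_digraph \<Rightarrow> 'a distribution \<Rightarrow> 'a set" where
  "dist_support G D = {v \<in> pverts G. D v > 0}"

definition pebbling_move ::
    "'a pair_pre_digraph \<Rightarrow> 'a distribution \<Rightarrow> 'a distribution \<Rightarrow> bool" where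
  "pebbling_move G D D' \<longleftrightarrow>
     (\<exists>u v. (u, v) \<in> parcs G \<and> 2 \<le> D u \<and> D' = D(u := D u - 2, v := D v + 1))"

definition solvable :: "'a pair_pre_digraph \<Rightarrow> nat \<Rightarrow> 'a distribution \<Rightarrow> bool" where
  "solvable G t D \<longleftrightarrow>
     (\<forall>v\<in>pverts G. \<exists>D'. (pebbling_move G)\<^sup>*\<^sup>* D D' \<and> t \<le> D' v)"

definition hypercube :: "nat \<Rightarrow> bool list pair_pre_digraph" where
  "hypercube d =
     \<lparr> pverts = {v. length v = d},
       parcs = {(u, v). length u = d \<and> length v = d \<and> card {i. i < d \<and> u ! i \<noteq> v ! i} = 1} \<rparr>"

lemma in_parcs_hypercube:
  "(u, v) \<in> parcs (hypercube d) \<longleftrightarrow>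
     length u = d \<and> length v = d \<and> card {i. i < d \<and> u ! i \<noteq> v ! i} = 1"
  unfolding hypercube_def pair_pre_digraph.select_convs mem_Collect_eq prod.case by (rule refl)

lemma pair_graph_hypercube: "pair_graph (hypercube d)"
proof -
  have pv: "pverts (hypercube d) = {v. length v = d}"
    unfolding hypercube_def pair_pre_digraph.select_convs by (rule refl)
  have finv: "finite (pverts (hypercube d))"
    unfolding pv using finite_lists_length_eq[of "UNIV :: bool set" d] by simp
  have sub: "parcs (hypercube d) \<subseteq> pverts (hypercube d) \<times> pverts (hypercube d)"
  proof (rule subrelI)
    fix u v assume "(u, v) \<in> parcs (hypercube d)"
    then show "(u, v) \<in> pverts (hypercube d) \<times> pverts (hypercube d)"
      unfolding in_parcs_hypercube pv by blast
  qed
  then have fina: "finite (parcs (hypercube d))"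
    by (rule finite_subset) (intro finite_cartesian_product finv)
  have verts: "fst e \<in> pverts (hypercube d)" "snd e \<in> pverts (hypercube d)"
    if "e \<in> parcs (hypercube d)" for e
    using subsetD[OF sub that] unfolding mem_Times_iff by (rule conjunct1, rule conjunct2)
  have loop: "fst e \<noteq> snd e" if "e \<in> parcs (hypercube d)" for e
  proof
    assume eq: "fst e = snd e"
    have "(fst e, snd e) \<in> parcs (hypercube d)"
      using that unfolding prod.collapse .
    then have "card {i. i < d \<and> snd e ! i \<noteq> snd e ! i} = 1"
      unfolding eq in_parcs_hypercube by blast
    then show False
      by simp
  qed
  have "sym (parcs (hypercube d))"
  proof (rule symI)
    fix u v assume "(u, v) \<in> parcs (hypercube d)"
    moreover have "{i. i < d \<and> u ! i \<noteq> v ! i} = {i. i < d \<and> v ! i \<noteq> u ! i}"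
      by blast
    ultimately show "(v, u) \<in> parcs (hypercube d)"
      unfolding in_parcs_hypercube by metis
  qed
  then have sym: "symmetric (with_proj (hypercube d))"
    unfolding symmetric_def arcs_ends_def by (simp add: with_proj_def arc_to_ends_def)
  show ?thesis
    by unfold_locales (fact verts loop finv fina sym)+
qed

text \<open>
  The distributions \<open>D\<^sub>r\<close> on \<open>K\<^sub>2\<close>; the vertices \<open>x\<^sub>0\<close> and \<open>x\<^sub>1\<close> are \<^term>\<open>False\<close> and
  \<^term>\<open>True\<close>, matching the bits 0 and 1.
\<close>

definition K2_dist :: "nat \<Rightarrow> bool distribution" where
  "K2_dist r b =
     (let k = r div 3 in
      if r mod 3 = 0 then 2 * k
      else if r mod 3 = 1 then (if b then 2 * k else 2 * k + 2)
      else (if b then 2 * k + 1 else 2 * k + 2))"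

lemma K2_dist_simps:
  "K2_dist (3 * k) False = 2 * k"          "K2_dist (3 * k) True = 2 * k"
  "K2_dist (3 * k + 1) False = 2 * k + 2"  "K2_dist (3 * k + 1) True = 2 * k"
  "K2_dist (3 * k + 2) False = 2 * k + 2"  "K2_dist (3 * k + 2) True = 2 * k + 1"
proof -
  have "(3 * k + 1) div 3 = k" "(3 * k + 1) mod 3 = 1" "(3 * k + 2) div 3 = k" "(3 * k + 2) mod 3 = 2"
    by presburger+
  then show "K2_dist (3 * k) False = 2 * k"          "K2_dist (3 * k) True = 2 * k"
    "K2_dist (3 * k + 1) False = 2 * k + 2"  "K2_dist (3 * k + 1) True = 2 * k"
    "K2_dist (3 * k + 2) False = 2 * k + 2"  "K2_dist (3 * k + 2) True = 2 * k + 1"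
    unfolding K2_dist_def Let_def by simp_all
qed

end

theory Submission
  imports Defs
begin

text \<open>
  From \<open>D\<^sub>r\<close> each of the two vertices of \<open>K\<^sub>2\<close> can receive \<open>r\<close> pebbles.  To reach
  a vertex of \<open>Q\<^bsup>d+1\<^esup>\<close> with last bit \<open>b\<close>, first move across the last coordinate everything
  that the layer \<open>1 - b\<close> can contribute; then layer \<open>b\<close> dominates \<open>D\<close> pointwise, and the moves that
  solve \<open>D\<close> can be copied inside this layer.  Both bounds hold already for each \<open>D\<^sub>r\<close>.
\<close>

text \<open>Since \<open>u \<noteq> v\<close>, pebbles arriving at \<open>v\<close> never refill
  \<open>u\<close>, so \<open>n\<close> moves along the same arc add up to one closed-form
  update.\<close>

lemma pebbling_move_iterate:
  assumes "(u, v) \<in> parcs G" "u \<noteq> v" "2 * n \<le> D u"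
  shows "(pebbling_move G)\<^sup>*\<^sup>* D (D(u := D u - 2 * n, v := D v + n))"
  using assms(3)
proof (induction n)
  case 0
  then show ?case by simp
next
  case (Suc n)
  let ?E = "D(u := D u - 2 * n, v := D v + n)"
  have "pebbling_move G ?E (?E(u := ?E u - 2, v := ?E v + 1))"
    unfolding pebbling_move_def using assms(1,2) Suc.prems by (intro exI[of _ u] exI[of _ v]) simp
  also have "?E(u := ?E u - 2, v := ?E v + 1) =
      D(u := D u - 2 * Suc n, v := D v + Suc n)"
    using assms(2) by (auto simp: fun_eq_iff)
  finally have "pebbling_move G ?E (D(u := D u - 2 * Suc n, v := D v + Suc n))" .
  moreover have "(pebbling_move G)\<^sup>*\<^sup>* D ?E"
    using Suc.prems by (intro Suc.IH) simp
  ultimately show ?case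
    by (rule rtranclp.rtrancl_into_rtrancl[rotated])
qed

text \<open>The arcs from \<open>f u\<close> to \<open>g u\<close> are pairwise vertex-disjoint, so
  every complete pair of pebbles can cross its arc without disturbing the others. The last conjunct
  carries the induction: the ends of the next arc still hold their original pebbles.\<close>

lemma pebbling_moves_along_matching:
  assumes "finite S" "inj_on f S" "inj_on g S" "f ` S \<inter> g ` S = {}"
    and "\<And>u. u \<in> S \<Longrightarrow> (f u, g u) \<in> parcs G"
  shows "\<exists>E. (pebbling_move G)\<^sup>*\<^sup>* D E \<and>
    (\<forall>u\<in>S. E (g u) = D (g u) + D (f u) div 2) \<and> (\<forall>x. x \<notin> f ` S \<union> g ` S \<longrightarrow> E x = D x)"
  using assms
proof (induction S rule: finite_induct)
  case empty
  then show ?case by auto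
next
  case (insert a S)
  then obtain E where E: "(pebbling_move G)\<^sup>*\<^sup>* D E"
    "\<forall>u\<in>S. E (g u) = D (g u) + D (f u) div 2" "\<forall>x. x \<notin> f ` S \<union> g ` S \<longrightarrow> E x = D x"
    by (auto simp: inj_on_insert)
  \<comment> \<open>Injectivity separates the new source from the old sources and likewise for the
    targets; disjointness of the images separates sources from targets.\<close>
  have new: "f a \<notin> f ` S \<union> g ` S" "g a \<notin> f ` S \<union> g ` S" "f a \<noteq> g a"
    using insert.prems insert.hyps by (auto simp: inj_on_def)
  let ?F = "E(f a := E (f a) - 2 * (E (f a) div 2), g a := E (g a) + E (f a) div 2)"
  have "(pebbling_move G)\<^sup>*\<^sup>* E ?F"
    using insert.prems new by (intro pebbling_move_iterate) auto
  with E(1) have "(pebbling_move G)\<^sup>*\<^sup>* D ?F"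
    by simp
  moreover have "?F (g u) = D (g u) + D (f u) div 2" if "u \<in> insert a S" for u
  proof (cases "u = a")
    case True
    then show ?thesis using E(3) new by simp
  next
    case False
    then have "u \<in> S" using that by simp
    then have "g u \<noteq> f a" "g u \<noteq> g a" using new by (metis UnI2 imageI)+
    then show ?thesis using E(2) \<open>u \<in> S\<close> by simp
  qed
  moreover have "\<forall>x. x \<notin> f ` insert a S \<union> g ` insert a S \<longrightarrow> ?F x = D x"
    using E(3) by simp
  ultimately show ?case by blast
qed

text \<open>Surplus pebbles never block a move, so domination along \<open>f\<close> survives when
  each move is copied. Arcs stay inside \<open>pverts G\<close>, which is where domination is
  known.\<close>

lemma pebbling_moves_mono_embedding:
  assumes "inj f" and arc: "\<And>u v. (u, v) \<in> parcs G \<Longrightarrow> (f u, f v) \<in> parcs H"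
    and sub: "parcs G \<subseteq> pverts G \<times> pverts G"
    and "(pebbling_move G)\<^sup>*\<^sup>* D D'" and "\<forall>u\<in>pverts G. D u \<le> E (f u)"
  shows "\<exists>E'. (pebbling_move H)\<^sup>*\<^sup>* E E' \<and> (\<forall>u\<in>pverts G. D' u \<le> E' (f u))"
  using assms(4)
proof induction
  case base
  then show ?case using assms(5) by blast
next
  case (step D1 D2)
  then obtain E1 where E1: "(pebbling_move H)\<^sup>*\<^sup>* E E1" "\<forall>u\<in>pverts G. D1 u \<le> E1 (f u)"
    by blast
  obtain u v where uv: "(u, v) \<in> parcs G" "2 \<le> D1 u"
    and D2: "D2 = D1(u := D1 u - 2, v := D1 v + 1)"
    using step.hyps(2) unfolding pebbling_move_def by blast
  let ?E2 = "E1(f u := E1 (f u) - 2, f v := E1 (f v) + 1)"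
  have in_verts: "u \<in> pverts G" "v \<in> pverts G"
    using uv(1) sub by auto
  have "2 \<le> E1 (f u)"
    using E1(2) in_verts uv(2) by (meson le_trans)
  then have "pebbling_move H E1 ?E2"
    unfolding pebbling_move_def using arc[OF uv(1)] by blast
  with E1(1) have "(pebbling_move H)\<^sup>*\<^sup>* E ?E2"
    by simp
  \<comment> \<open>By injectivity the copied move changes \<open>f w\<close> only for
    \<open>w = u\<close> or \<open>w = v\<close>, and there it acts on both distributions
    alike.\<close>
  moreover have "\<forall>w\<in>pverts G. D2 w \<le> ?E2 (f w)"
    using E1(2) in_verts injD[OF \<open>inj f\<close>] unfolding D2 by (auto intro: diff_le_mono)
  ultimately show ?case by blast
qed

lemma pverts_hypercube: "pverts (hypercube d) = {v. length v = d}"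
  by (simp add: hypercube_def)

text \<open>Splitting off the last bit gives two disjoint layers, over which targets, sizes and
  supports are then treated separately.\<close>

lemma pverts_hypercube_Suc:
  "pverts (hypercube (Suc d)) =
     (\<lambda>v. v @ [False]) ` pverts (hypercube d) \<union> (\<lambda>v. v @ [True]) ` pverts (hypercube d)"
proof -
  have "w \<in> (\<lambda>v. v @ [False]) ` {v. length v = d} \<union> (\<lambda>v. v @ [True]) ` {v. length v = d}"
    if len: "length w = Suc d" for w :: "bool list"
  proof -
    obtain v b where "w = v @ [b]" "length v = d"
      using len by (cases w rule: rev_cases) auto
    then show ?thesis by (cases b) auto
  qed
  then show ?thesis unfolding pverts_hypercube by auto
qed

lemma finite_pverts_hypercube: "finite (pverts (hypercube d))"
  unfolding pverts_hypercube using finite_lists_length_eq[of "UNIV :: bool set" d] by simp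

lemma hypercube_arc_snoc:
  assumes "(u, v) \<in> parcs (hypercube d)"
  shows "(u @ [b], v @ [b]) \<in> parcs (hypercube (Suc d))"
proof -
  have "{i. i < Suc d \<and> (u @ [b]) ! i \<noteq> (v @ [b]) ! i} = {i. i < d \<and> u ! i \<noteq> v ! i}"
    using assms by (auto simp: in_parcs_hypercube nth_append less_Suc_eq)
  then show ?thesis using assms by (simp add: in_parcs_hypercube)
qed

lemma hypercube_arc_last:
  assumes "v \<in> pverts (hypercube d)" "b \<noteq> c"
  shows "(v @ [b], v @ [c]) \<in> parcs (hypercube (Suc d))"
proof -
  have "{i. i < Suc d \<and> (v @ [b]) ! i \<noteq> (v @ [c]) ! i} = {d}"
    using assms by (auto simp: pverts_hypercube nth_append less_Suc_eq)
  then show ?thesis using assms by (simp add: in_parcs_hypercube pverts_hypercube)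
qed

text \<open>For \<open>r = 3k\<close>, \<open>3k+1\<close>, \<open>3k+2\<close> the right-hand side
  is \<open>3k\<close>, \<open>3k+2\<close>, \<open>3k+2\<close> at \<open>False\<close> and
  \<open>3k\<close>, \<open>3k+1\<close>, \<open>3k+2\<close> at \<open>True\<close>.\<close>

lemma K2_dist_reaches: "r \<le> K2_dist r b + K2_dist r (\<not> b) div 2"
  unfolding K2_dist_def Let_def by (cases b) (simp_all, presburger+)

lemma K2_dist_size: "3 * (K2_dist r False + K2_dist r True) \<le> 4 * r + (if r > 0 then 2 else 0)"
  unfolding K2_dist_def Let_def by (simp, presburger)

lemma K2_dist_0 [simp]: "K2_dist 0 b = 0"
  by (simp add: K2_dist_def)

context
  fixes d :: nat and D D' :: "bool list distribution"
  assumes D': "\<forall>v\<in>pverts (hypercube d). \<forall>b. D' (v @ [b]) = K2_dist (D v) b"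
begin

lemma solvable_K2_dist:
  assumes "solvable (hypercube d) t D"
  shows "solvable (hypercube (Suc d)) t D'"
  unfolding solvable_def
proof
  let ?H = "hypercube (Suc d)"
  fix w assume "w \<in> pverts ?H"
  then obtain v b where w: "w = v @ [b]" and v: "v \<in> pverts (hypercube d)"
    unfolding pverts_hypercube_Suc by auto
  obtain F where F: "(pebbling_move (hypercube d))\<^sup>*\<^sup>* D F" "t \<le> F v"
    using assms v unfolding solvable_def by blast
  have "\<exists>E. (pebbling_move ?H)\<^sup>*\<^sup>* D' E \<and>
      (\<forall>u\<in>pverts (hypercube d). E (u @ [b]) = D' (u @ [b]) + D' (u @ [\<not> b]) div 2) \<and>
      (\<forall>x. x \<notin> (\<lambda>u. u @ [\<not> b]) ` pverts (hypercube d) \<union>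
        (\<lambda>u. u @ [b]) ` pverts (hypercube d) \<longrightarrow> E x = D' x)"
    by (intro pebbling_moves_along_matching finite_pverts_hypercube hypercube_arc_last)
      (auto simp: inj_on_def)
  then obtain E where E: "(pebbling_move ?H)\<^sup>*\<^sup>* D' E"
    "\<forall>u\<in>pverts (hypercube d). E (u @ [b]) = D' (u @ [b]) + D' (u @ [\<not> b]) div 2"
    by blast
  have "\<exists>E'. (pebbling_move ?H)\<^sup>*\<^sup>* E E' \<and> (\<forall>u\<in>pverts (hypercube d). F u \<le> E' (u @ [b]))"
  proof (rule pebbling_moves_mono_embedding[OF _ hypercube_arc_snoc _ F(1)])
    show "inj (\<lambda>u. u @ [b])" by (simp add: inj_on_def)
    show "parcs (hypercube d) \<subseteq> pverts (hypercube d) \<times> pverts (hypercube d)"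
      by (auto simp: in_parcs_hypercube pverts_hypercube)
    \<comment> \<open>After the crossing, \<open>u @ [b]\<close> holds its own pebbles plus half of
      those of its partner, rounded down, which is at least \<open>D u\<close>.\<close>
    show "\<forall>u\<in>pverts (hypercube d). D u \<le> E (u @ [b])"
      using E(2) D' K2_dist_reaches by simp
  qed
  then obtain E' where "(pebbling_move ?H)\<^sup>*\<^sup>* E E'" "F v \<le> E' w"
    unfolding w using v by blast
  then show "\<exists>E. (pebbling_move ?H)\<^sup>*\<^sup>* D' E \<and> t \<le> E w"
    using E(1) F(2) by (meson le_trans rtranclp_trans)
qed

lemma dist_size_K2_dist:
  "3 * dist_size (hypercube (Suc d)) D' \<le>
     4 * dist_size (hypercube d) D + 2 * card (dist_support (hypercube d) D)"
proof -
  let ?V = "pverts (hypercube d)"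
  have "dist_size (hypercube (Suc d)) D' = (\<Sum>v\<in>?V. D' (v @ [False])) + (\<Sum>v\<in>?V. D' (v @ [True]))"
    unfolding dist_size_def pverts_hypercube_Suc
    by (subst sum.union_disjoint)
      (auto simp: finite_pverts_hypercube sum.reindex inj_on_def)
  also have "\<dots> = (\<Sum>v\<in>?V. K2_dist (D v) False + K2_dist (D v) True)"
    by (simp add: D' sum.distrib)
  finally have "3 * dist_size (hypercube (Suc d)) D' =
      (\<Sum>v\<in>?V. 3 * (K2_dist (D v) False + K2_dist (D v) True))"
    by (simp add: sum_distrib_left)
  also have "\<dots> \<le> (\<Sum>v\<in>?V. 4 * D v + (if D v > 0 then 2 else 0))"
    by (intro sum_mono K2_dist_size)
  \<comment> \<open>The conditional summands contribute 2 for each vertex of the support.\<close>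
  also have "\<dots> = 4 * dist_size (hypercube d) D + 2 * card (dist_support (hypercube d) D)"
    by (simp add: dist_size_def dist_support_def sum.distrib sum_distrib_left finite_pverts_hypercube
        sum.If_cases Int_def)
  finally show ?thesis .
qed

lemma card_dist_support_K2_dist:
  "card (dist_support (hypercube (Suc d)) D') \<le> 2 * card (dist_support (hypercube d) D)"
proof -
  let ?S = "dist_support (hypercube d) D"
  have fin: "finite ?S"
    by (simp add: dist_support_def finite_pverts_hypercube)
  \<comment> \<open>An unpebbled \<open>v\<close> yields two unpebbled vertices, because
    \<open>K2_dist 0 b = 0\<close>.\<close>
  have "dist_support (hypercube (Suc d)) D' \<subseteq> (\<lambda>v. v @ [False]) ` ?S \<union> (\<lambda>v. v @ [True]) ` ?S"
    unfolding dist_support_def pverts_hypercube_Suc by (auto simp: D' intro!: imageI gr0I)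
  then have "card (dist_support (hypercube (Suc d)) D') \<le>
      card ((\<lambda>v. v @ [False]) ` ?S \<union> (\<lambda>v. v @ [True]) ` ?S)"
    using fin by (intro card_mono) auto
  also have "\<dots> \<le> card ((\<lambda>v. v @ [False]) ` ?S) + card ((\<lambda>v. v @ [True]) ` ?S)"
    by (rule card_Un_le)
  also have "\<dots> \<le> 2 * card ?S"
    using card_image_le[OF fin, of "\<lambda>v. v @ [False]"] card_image_le[OF fin, of "\<lambda>v. v @ [True]"]
    by simp
  finally show ?thesis .
qed

end

theorem theorem6p4:
  fixes d t :: nat and D D' :: "bool list distribution"
  assumes "d \<ge> 1" and "t \<ge> 1"
    and "solvable (hypercube d) t D"
    and "\<And>v. v \<in> pverts (hypercube d) \<Longrightarrow> D' (v @ [False]) = K2_dist (D v) False"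
    and "\<And>v. v \<in> pverts (hypercube d) \<Longrightarrow> D' (v @ [True]) = K2_dist (D v) True"
  shows "solvable (hypercube (d + 1)) t D' \<and>
    real (dist_size (hypercube (d + 1)) D')
      \<le> 4 / 3 * real (dist_size (hypercube d) D)
        + 2 / 3 * real (card (dist_support (hypercube d) D)) \<and>
    card (dist_support (hypercube (d + 1)) D') \<le> 2 * card (dist_support (hypercube d) D)"
proof -
  \<comment> \<open>Quantifying over the bit lets one argument serve targets in both layers.\<close>
  have D': "\<forall>v\<in>pverts (hypercube d). \<forall>b. D' (v @ [b]) = K2_dist (D v) b"
    using assms(4,5) by (metis (full_types))
  have "real (dist_size (hypercube (Suc d)) D') \<le> 4 / 3 * real (dist_size (hypercube d) D)
      + 2 / 3 * real (card (dist_support (hypercube d) D))"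
    using dist_size_K2_dist[OF D'] by linarith
  then show ?thesis
    using solvable_K2_dist[OF D' assms(3)] card_dist_support_K2_dist[OF D'] by simp
qed

end
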